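(* Let $K_n=(V,E)$ be the complete graph with $|V|=n\ge 2$, and let $X$ be a cut of cardinality $k$. Then the degree of the vertex $K^{+}_{\min}(X)$ in the graph of the cone partition for the min-cut problem with non-negative edges equals $2^{n-k}+2^{k}-4$.
   Context: Let $d=\binom{n}{2}=|E|$. For $S\subseteq V$, the cut vector $\mathbf{v}(S)\in\{0,1\}^{d}$ has coordinates indexed by edges $\{i,j\}\in E$, with $\mathbf{v}(S)_{i,j}=1$ if $|S\cap\{i,j\}|=1$ and $0$ otherwise. A cut is a nonempty proper subset $X\subset V$, where $X$ and its complement $V\setminus X$ are identified; the empty cut is excluded, so there are $2^{n-1}-1$ cuts. The cardinality of a cut $S$ is $\min(|S|,|V\setminus S|)$. For a cut $X$, $K^{+}_{\min}(X)=\{\mathbf{c}\in\mathbb{R}^{d}:\ \mathbf{c}\ge\mathbf{0},\ \langle\mathbf{c},\mathbf{v}(X)\rangle\le\langle\mathbf{c},\mathbf{v}(Y)\rangle \text{ for all cuts } Y\}$. Two cones $K^{+}_{\min}(X),K^{+}_{\min}(Y)$ with $X\ne Y$ are adjacent if $\dim\big(K^{+}_{\min}(X)\cap K^{+}_{\min}(Y)\big)=d-1$. The graph of the cone partition has one vertex per cut and an edge between two cones iff they are adjacent; the degree of a vertex is its number of neighbours in this graph. *)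

theory Defs
  imports "HOL-Analysis.Analysis"
begin

text \<open>The vertex set \<open>V\<close> of \<open>K\<^sub>n\<close> is the universe of a finite type \<open>'v\<close>; the class \<open>card2\<close>
  (finite with at least two elements) says exactly \<open>n \<ge> 2\<close>, which makes \<open>E\<close> nonempty. Indexing by
  the type of edges, \<open>real ^ 'v edge\<close> is \<open>\<real>\<^sup>d\<close> with \<open>d = n choose 2\<close>.\<close>

typedef ('v::card2) edge = "{e :: 'v set. card e = 2}"
  morphisms endpoints Edge
proof -
  obtain e :: "'v set" where "card e = 2"
    by (metis obtain_subset_with_card_n two_le_card)
  then show ?thesis by blast
qed

lemma bij_endpoints: "bij_betw endpoints UNIV {e :: 'v::card2 set. card e = 2}"
  by (metis bij_betw_def endpoints_inject injI type_definition.Rep_range type_definition_edge)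

instance edge :: (card2) finite
proof
  show "finite (UNIV :: 'a edge set)"
    using bij_betw_finite[OF bij_endpoints] by simp
qed

lemma card_edge: "CARD('v::card2 edge) = CARD('v) choose 2"
  using bij_betw_same_card[OF bij_endpoints[where 'v='v]] n_subsets[of "UNIV :: 'v set" 2] by simp

text \<open>A cut is a nonempty proper subset of \<open>V\<close>, identified with its complement.\<close>

definition cut_rel :: "'v set \<Rightarrow> 'v set \<Rightarrow> bool" where
  "cut_rel S T \<longleftrightarrow> S \<noteq> {} \<and> S \<noteq> UNIV \<and> (T = S \<or> T = - S)"

quotient_type 'v cut = "'v::card2 set" / partial: cut_rel
proof (rule part_equivpI)
  obtain a b :: 'v where "a \<noteq> b"
    by (metis card2_class.two_le_card card_2_iff obtain_subset_with_card_n)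
  then show "\<exists>S :: 'v set. cut_rel S S"
    unfolding cut_rel_def by (intro exI[of _ "{a}"]) auto
  show "symp (cut_rel :: 'v set \<Rightarrow> _)"
    by (rule sympI) (auto simp: cut_rel_def)
  show "transp (cut_rel :: 'v set \<Rightarrow> _)"
    by (rule transpI) (auto simp: cut_rel_def)
qed

instance cut :: (card2) finite
proof
  have "inj (rep_cut :: 'a cut \<Rightarrow> 'a set)"
    by (metis Quotient3_abs_rep Quotient3_cut injI)
  then show "finite (UNIV :: 'a cut set)"
    by (rule finite_imageD[rotated]) simp
qed

lift_definition cut_vector :: "'v::card2 cut \<Rightarrow> real ^ 'v edge" is
  "\<lambda>S. \<chi> e. if card (S \<inter> endpoints e) = 1 then 1 else 0"
proof -
  fix S T :: "'v set"
  assume "cut_rel S T"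
  moreover have "card (- S \<inter> endpoints e) = 1 \<longleftrightarrow> card (S \<inter> endpoints e) = 1" for e
  proof -
    have "card (endpoints e) = 2" using endpoints[of e] by simp
    moreover have "card (endpoints e) = card (S \<inter> endpoints e) + card (- S \<inter> endpoints e)"
      by (subst card_Un_disjoint[symmetric]) (auto intro: arg_cong[where f=card])
    ultimately show ?thesis by linarith
  qed
  ultimately show "(\<chi> e. if card (S \<inter> endpoints e) = 1 then 1 else 0) =
      (\<chi> e. if card (T \<inter> endpoints e) = 1 then 1 else (0::real))"
    by (auto simp: cut_rel_def)
qed

lift_definition cut_card :: "'v::card2 cut \<Rightarrow> nat" is
  "\<lambda>S. min (card S) (card (- S))"
  by (auto simp: cut_rel_def min.commute)

definition K_min :: "'v::card2 cut \<Rightarrow> (real ^ 'v edge) set" where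
  "K_min X = {c. (\<forall>e. 0 \<le> c $ e) \<and> (\<forall>Y. c \<bullet> cut_vector X \<le> c \<bullet> cut_vector Y)}"

text \<open>\<open>dim\<close> is the dimension of the linear span; the cones contain the origin, so it is also that
  of the affine hull. The subtraction is not truncated, as \<open>CARD('v) \<ge> 2\<close>.\<close>

definition cone_adjacent :: "'v::card2 cut \<Rightarrow> 'v cut \<Rightarrow> bool" where
  "cone_adjacent X Y \<longleftrightarrow> X \<noteq> Y \<and> dim (K_min X \<inter> K_min Y) = (CARD('v) choose 2) - 1"

text \<open>The vertices of the graph of the cone partition are the cuts, the edges are given by
  \<open>cone_adjacent\<close>.\<close>

definition cone_degree :: "'v::card2 cut \<Rightarrow> nat" where
  "cone_degree X = card {Y. cone_adjacent X Y}"

end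

theory Submission imports Defs begin

text \<open>
  Two distinct cuts are adjacent iff they do not cross, i.e. iff after complementation one of them
  is a proper subset of the other.
  If \<open>X\<close> and \<open>Y\<close> cross, submodularity of the cut function, applied to \<open>X, Y\<close> and to \<open>X, -Y\<close>, forces
  every common minimiser to vanish on an edge between \<open>X - Y\<close> and \<open>Y - X\<close> and on an edge between
  \<open>X \<inter> Y\<close> and \<open>-(X \<union> Y)\<close>, so the intersection has codimension at least two.
  If \<open>Y \<subset> X\<close>, put \<open>A = Y\<close>, \<open>B = X - Y\<close>, \<open>C = -X\<close>. Give weight 4 to edges inside a class and total
  weights 2, 2, 1 to the edges between \<open>A\<close> and \<open>B\<close>, \<open>B\<close> and \<open>C\<close>, \<open>A\<close> and \<open>C\<close>. Then \<open>X\<close> and \<open>Y\<close> have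
  weight 3, every other cut has weight at least 4, and the strict inequalities persist in a
  neighbourhood inside the hyperplane where \<open>X\<close> and \<open>Y\<close> have equal weight.
  The non-crossing cuts are represented by the nonempty proper subsets of \<open>X\<close> and of \<open>-X\<close>.
\<close>

section \<open>Edges between vertex sets\<close>

definition edges_between :: "'v::card2 set \<Rightarrow> 'v set \<Rightarrow> 'v edge set" where
  "edges_between A B = {e. \<exists>a\<in>A. \<exists>b\<in>B. a \<noteq> b \<and> endpoints e = {a, b}}"

lemma mem_edges_between_iff:
  assumes "a \<noteq> b" "endpoints e = {a, b}"
  shows "e \<in> edges_between A B \<longleftrightarrow> a \<in> A \<and> b \<in> B \<or> a \<in> B \<and> b \<in> A"
proof
  assume "e \<in> edges_between A B"
  then obtain x y where "x \<in> A" "y \<in> B" "{a, b} = {x, y}"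
    unfolding edges_between_def using assms(2) by auto
  then show "a \<in> A \<and> b \<in> B \<or> a \<in> B \<and> b \<in> A"
    by (auto simp: doubleton_eq_iff)
next
  assume "a \<in> A \<and> b \<in> B \<or> a \<in> B \<and> b \<in> A"
  then show "e \<in> edges_between A B"
  proof
    assume "a \<in> A \<and> b \<in> B"
    then show ?thesis
      unfolding edges_between_def mem_Collect_eq using assms by (intro bexI[of _ a] bexI[of _ b]) auto
  next
    assume "a \<in> B \<and> b \<in> A"
    then show ?thesis
      unfolding edges_between_def mem_Collect_eq using assms by (intro bexI[of _ b] bexI[of _ a]) auto
  qed
qed

lemma edge_cases:
  fixes e :: "'v::card2 edge"
  obtains a b where "a \<noteq> b" "endpoints e = {a, b}"
proof -
  have "card (endpoints e) = 2" using endpoints[of e] by simp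
  then show ?thesis using that unfolding card_2_iff by blast
qed

lemma edges_between_commute:
  "edges_between A B = edges_between B A"
proof (rule set_eqI)
  show "e \<in> edges_between A B \<longleftrightarrow> e \<in> edges_between B A" for e
    by (rule edge_cases[of e]) (auto simp: mem_edges_between_iff)
qed

lemma edges_between_Un_left:
  "edges_between (A \<union> B) C = edges_between A C \<union> edges_between B C"
proof (rule set_eqI)
  show "e \<in> edges_between (A \<union> B) C \<longleftrightarrow> e \<in> edges_between A C \<union> edges_between B C" for e
    by (rule edge_cases[of e]) (simp add: mem_edges_between_iff, blast)
qed

lemma edges_between_Un_right:
  "edges_between A (B \<union> C) = edges_between A B \<union> edges_between A C"
proof (rule set_eqI)
  show "e \<in> edges_between A (B \<union> C) \<longleftrightarrow> e \<in> edges_between A B \<union> edges_between A C" for e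
    by (rule edge_cases[of e]) (simp add: mem_edges_between_iff, blast)
qed

lemma edge_exists:
  fixes a b :: "'v::card2"
  assumes "a \<noteq> b"
  obtains e where "endpoints e = {a, b}"
proof -
  have "endpoints (Edge {a, b}) = {a, b}"
    using assms by (intro Edge_inverse) simp
  then show ?thesis using that by blast
qed

lemma edges_between_nonempty:
  assumes "A \<inter> B = {}" "A \<noteq> {}" "B \<noteq> {}"
  shows "edges_between A B \<noteq> {}"
proof -
  obtain a b where "a \<in> A" "b \<in> B" using assms by blast
  moreover then have "a \<noteq> b" using assms by blast
  moreover then obtain e where "endpoints e = {a, b}" by (rule edge_exists)
  ultimately show ?thesis unfolding edges_between_def by blast
qed

lemma card_Int_endpoints:
  assumes "a \<noteq> b" "endpoints e = {a, b}"
  shows "card (S \<inter> endpoints e) = 1 \<longleftrightarrow> (a \<in> S) \<noteq> (b \<in> S)"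
  unfolding assms(2) using assms(1) by (cases "a \<in> S"; cases "b \<in> S") simp_all

section \<open>Cut vectors of vertex sets, and cuts through their representatives\<close>

definition set_vector :: "'v::card2 set \<Rightarrow> real ^ 'v edge" where
  "set_vector S = (\<chi> e. if card (S \<inter> endpoints e) = 1 then 1 else 0)"

lemma set_vector_nth:
  assumes "a \<noteq> b" "endpoints e = {a, b}"
  shows "set_vector S $ e = (if (a \<in> S) \<noteq> (b \<in> S) then 1 else 0)"
  by (simp only: set_vector_def vec_lambda_beta card_Int_endpoints[OF assms])

lemma set_vector_Compl: "set_vector (- S) = set_vector S"
proof -
  have "set_vector (- S) $ e = set_vector S $ e" for e
    by (rule edge_cases[of e]) (auto simp: set_vector_nth)
  then show ?thesis by (simp add: vec_eq_iff)
qed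

lemma set_vector_nth_between:
  "set_vector S $ e = (if e \<in> edges_between S (- S) then 1 else 0)"
proof -
  obtain a b where ab: "a \<noteq> b" "endpoints e = {a, b}" by (rule edge_cases)
  then have "e \<in> edges_between S (- S) \<longleftrightarrow> (a \<in> S) \<noteq> (b \<in> S)"
    by (auto simp: mem_edges_between_iff)
  then show ?thesis using set_vector_nth[OF ab] by simp
qed

lemma inner_set_vector:
  "c \<bullet> set_vector S = sum (($) c) (edges_between S (- S))"
proof -
  have "c \<bullet> set_vector S = (\<Sum>e\<in>UNIV. if e \<in> edges_between S (- S) then c $ e else 0)"
    unfolding inner_vec_def set_vector_nth_between by (rule sum.cong) auto
  then show ?thesis by (simp add: sum.If_cases)
qed

lemma cut_vector_abs_cut:
  assumes "S \<noteq> {}" "S \<noteq> UNIV"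
  shows "cut_vector (abs_cut S) = set_vector S"
  using assms by (simp add: cut_vector.abs_eq cut_rel_def set_vector_def)

lemma cut_card_abs_cut:
  assumes "S \<noteq> {}" "S \<noteq> UNIV"
  shows "cut_card (abs_cut S) = min (card S) (card (- S))"
  using assms by (simp add: cut_card.abs_eq cut_rel_def)

lemma abs_cut_eq_iff:
  assumes "S \<noteq> {}" "S \<noteq> UNIV" "T \<noteq> {}" "T \<noteq> UNIV"
  shows "abs_cut S = abs_cut T \<longleftrightarrow> T = S \<or> T = - S"
proof -
  have "cut_rel S S" "cut_rel T T" using assms by (auto simp: cut_rel_def)
  then have "abs_cut S = abs_cut T \<longleftrightarrow> cut_rel S T"
    using Quotient3_rel[OF Quotient3_cut, of S T] by blast
  then show ?thesis using assms by (auto simp: cut_rel_def)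
qed

lemma abs_cut_Compl:
  assumes "S \<noteq> {}" "S \<noteq> UNIV"
  shows "abs_cut (- S) = abs_cut S"
proof -
  have "- S \<noteq> {}" "- S \<noteq> UNIV" using assms by auto
  then show ?thesis using assms by (simp add: abs_cut_eq_iff)
qed

lemma cut_cases:
  obtains S where "S \<noteq> {}" "S \<noteq> UNIV" "X = abs_cut S"
proof -
  have "cut_rel (rep_cut X) (rep_cut X)" "abs_cut (rep_cut X) = X"
    using Quotient3_rep_reflp[OF Quotient3_cut] Quotient3_abs_rep[OF Quotient3_cut] by auto
  then show ?thesis using that[of "rep_cut X"] by (simp add: cut_rel_def)
qed

lemma cut_vector_inject:
  assumes "cut_vector X = cut_vector Y"
  shows "X = Y"
proof -
  obtain S where S: "S \<noteq> {}" "S \<noteq> UNIV" "X = abs_cut S" by (rule cut_cases)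
  obtain T where T: "T \<noteq> {}" "T \<noteq> UNIV" "Y = abs_cut T" by (rule cut_cases)
  have eq: "set_vector S = set_vector T"
    using assms S T by (simp add: cut_vector_abs_cut)
  have sep: "(a \<in> S) \<noteq> (b \<in> S) \<longleftrightarrow> (a \<in> T) \<noteq> (b \<in> T)" for a b
  proof (cases "a = b")
    case False
    then obtain e where e: "endpoints e = {a, b}" by (rule edge_exists)
    have "set_vector S $ e = set_vector T $ e" using eq by simp
    then show ?thesis
      by (simp add: set_vector_nth[OF False e] split: if_splits)
  qed simp
  have "T = S \<or> T = - S"
  \<comment> \<open>Here \<open>undefined\<close> is just an arbitrary base vertex. By
    \<open>sep\<close>, agreement or disagreement of \<open>S\<close> and \<open>T\<close> at one
    vertex propagates to all vertices.\<close>
  proof (cases "undefined \<in> S \<longleftrightarrow> undefined \<in> T")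
    case True
    then have "T = S" using sep[of undefined] by blast
    then show ?thesis ..
  next
    case False
    then have "T = - S" using sep[of undefined] by blast
    then show ?thesis ..
  qed
  then show ?thesis using S T by (simp add: abs_cut_eq_iff)
qed

section \<open>Common minimisers of crossing cuts\<close>

lemma K_min_abs_cut_iff:
  assumes "S \<noteq> {}" "S \<noteq> UNIV"
  shows "c \<in> K_min (abs_cut S) \<longleftrightarrow> (\<forall>e. 0 \<le> c $ e) \<and>
    (\<forall>T. T \<noteq> {} \<longrightarrow> T \<noteq> UNIV \<longrightarrow> c \<bullet> set_vector S \<le> c \<bullet> set_vector T)"
proof -
  have "(\<forall>Y. P (cut_vector Y)) \<longleftrightarrow> (\<forall>T. T \<noteq> {} \<longrightarrow> T \<noteq> UNIV \<longrightarrow> P (set_vector T))" for P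
    by (metis cut_cases cut_vector_abs_cut)
  from this[of "\<lambda>v. c \<bullet> set_vector S \<le> c \<bullet> v"] show ?thesis
    using assms by (simp add: K_min_def cut_vector_abs_cut)
qed

text \<open>The two side conditions make the intersection and the union cuts, so minimality of
  \<open>S\<close> and \<open>T\<close> bounds their total weight by that of these two cuts. The
  submodularity gap in the other direction counts each edge between \<open>S - T\<close> and
  \<open>T - S\<close> twice, and weights are nonnegative.\<close>

lemma common_minimiser_zero_between:
  assumes "c \<in> K_min (abs_cut S) \<inter> K_min (abs_cut T)"
    and "S \<inter> T \<noteq> {}" "S \<union> T \<noteq> UNIV"
    and "e \<in> edges_between (S - T) (T - S)"
  shows "c $ e = 0"
proof -
  have ne: "S \<noteq> {}" "S \<noteq> UNIV" "T \<noteq> {}" "T \<noteq> UNIV" "S \<inter> T \<noteq> UNIV" "S \<union> T \<noteq> {}"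
    using assms(2,3) by auto
  have nonneg: "0 \<le> c $ e" for e
    using assms(1) ne by (auto simp: K_min_abs_cut_iff)
  have "c \<bullet> set_vector S \<le> c \<bullet> set_vector (S \<inter> T)" "c \<bullet> set_vector T \<le> c \<bullet> set_vector (S \<union> T)"
    using assms(1-3) ne by (auto simp: K_min_abs_cut_iff)
  then have "0 \<ge> c \<bullet> (set_vector S + set_vector T - set_vector (S \<inter> T) - set_vector (S \<union> T))"
    by (simp add: inner_diff_right inner_add_right)
  \<comment> \<open>Coordinatewise, the combination of cut vectors is 2 on the edges between
    \<open>S - T\<close> and \<open>T - S\<close> and 0 elsewhere, so it dominates twice the unit
    vector of \<open>e\<close>.\<close>
  moreover have "c $ f * (2 * axis e 1 $ f) \<le>
      c $ f * (set_vector S + set_vector T - set_vector (S \<inter> T) - set_vector (S \<union> T)) $ f" for f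
  proof (rule mult_left_mono[OF _ nonneg])
    obtain a b where ab: "a \<noteq> b" "endpoints f = {a, b}" by (rule edge_cases)
    have "f = e \<Longrightarrow> a \<in> S - T \<and> b \<in> T - S \<or> b \<in> S - T \<and> a \<in> T - S"
      using assms(4) ab by (auto simp: mem_edges_between_iff)
    then show "2 * axis e 1 $ f \<le>
        (set_vector S + set_vector T - set_vector (S \<inter> T) - set_vector (S \<union> T)) $ f"
      by (auto simp: set_vector_nth[OF ab] axis_def)
  qed
  then have "c \<bullet> (2 *\<^sub>R axis e 1) \<le>
      c \<bullet> (set_vector S + set_vector T - set_vector (S \<inter> T) - set_vector (S \<union> T))"
    unfolding inner_vec_def by (intro sum_mono) simp
  ultimately have "c $ e \<le> 0" by (simp add: inner_axis)
  then show ?thesis using nonneg[of e] by simp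
qed

text \<open>Such a \<open>K\<close> lies in the span of the other unit vectors.\<close>

lemma dim_le_of_two_zero_coordinates:
  fixes K :: "(real ^ 'n) set"
  assumes "e \<noteq> f" and zero: "\<And>c. c \<in> K \<Longrightarrow> c $ e = 0 \<and> c $ f = 0"
  shows "dim K \<le> CARD('n) - 2"
proof -
  have "c \<in> span ((\<lambda>g. axis g 1) ` (- {e, f}))" if "c \<in> K" for c
  proof -
    have "c = (\<Sum>g\<in>UNIV. c $ g *\<^sub>R axis g 1)"
      by (simp add: basis_expansion flip: scalar_mult_eq_scaleR)
    also have "\<dots> = (\<Sum>g\<in>- {e, f}. c $ g *\<^sub>R axis g 1)"
      using zero[OF that] by (intro sum.mono_neutral_right) auto
    also have "\<dots> \<in> span ((\<lambda>g. axis g 1) ` (- {e, f}))"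
      by (intro span_sum span_scale span_base) auto
    finally show ?thesis .
  qed
  then have "dim K \<le> card ((\<lambda>g. axis g 1 :: real ^ 'n) ` (- {e, f}))"
    by (intro dim_le_card) auto
  also have "\<dots> \<le> card (- {e, f})" by (rule card_image_le) simp
  also have "\<dots> = CARD('n) - 2" using assms(1) by (simp add: Compl_eq_Diff_UNIV card_Diff_subset)
  finally show ?thesis .
qed

lemma crossing_not_adjacent:
  fixes S T :: "'v::card2 set"
  assumes "S \<inter> T \<noteq> {}" "S - T \<noteq> {}" "T - S \<noteq> {}" "S \<union> T \<noteq> UNIV"
  shows "\<not> cone_adjacent (abs_cut S) (abs_cut T)"
proof -
  have T: "T \<noteq> {}" "T \<noteq> UNIV" using assms by auto
  obtain e where e: "e \<in> edges_between (S - T) (T - S)"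
    using edges_between_nonempty[of "S - T" "T - S"] assms by blast
  \<comment> \<open>Complementing \<open>T\<close> keeps the cut but exchanges the quadrants: these
    two sets are the intersection of \<open>S\<close> and \<open>T\<close> and the complement of
    their union.\<close>
  obtain f where f: "f \<in> edges_between (S - - T) (- T - S)"
    using edges_between_nonempty[of "S - - T" "- T - S"] assms by blast
  have "e \<noteq> f" using e f by (auto simp: edges_between_def doubleton_eq_iff)
  have "c $ e = 0 \<and> c $ f = 0" if c: "c \<in> K_min (abs_cut S) \<inter> K_min (abs_cut T)" for c
  proof
    show "c $ e = 0"
      using assms c e by (intro common_minimiser_zero_between[of c S T])
    have "c \<in> K_min (abs_cut S) \<inter> K_min (abs_cut (- T))"
      using c abs_cut_Compl[OF T] by simp
    then show "c $ f = 0"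
      using assms f by (intro common_minimiser_zero_between[of c S "- T"]) auto
  qed
  with \<open>e \<noteq> f\<close> have "dim (K_min (abs_cut S) \<inter> K_min (abs_cut T)) \<le> CARD('v edge) - 2"
    by (rule dim_le_of_two_zero_coordinates)
  then have "dim (K_min (abs_cut S) \<inter> K_min (abs_cut T)) \<le> (CARD('v) choose 2) - 2"
    by (simp add: card_edge)
  \<comment> \<open>Two distinct edges give d \<ge> 2, so that d - 2 < d - 1 holds despite truncated
    subtraction.\<close>
  moreover have "card {e, f} \<le> CARD('v edge)" by (rule card_mono) auto
  then have "2 \<le> CARD('v) choose 2" using \<open>e \<noteq> f\<close> by (simp add: card_edge)
  ultimately show ?thesis by (auto simp: cone_adjacent_def)
qed

section \<open>Adjacency of nested cuts\<close>

text \<open>The tie between \<open>X\<close> and \<open>Y\<close> confines the common cone to a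
  hyperplane. Since all other constraints are strict at \<open>c\<close>, the cone contains a
  neighbourhood of \<open>c\<close> in this hyperplane and hence spans it.\<close>

lemma cone_adjacent_if_strict_minimiser:
  fixes X Y :: "'v::card2 cut"
  assumes "X \<noteq> Y" and pos: "\<And>e. 0 < c $ e"
    and eq: "c \<bullet> cut_vector X = c \<bullet> cut_vector Y"
    and less: "\<And>Z. Z \<noteq> X \<Longrightarrow> Z \<noteq> Y \<Longrightarrow> c \<bullet> cut_vector X < c \<bullet> cut_vector Z"
  shows "cone_adjacent X Y"
proof -
  let ?K = "K_min X \<inter> K_min Y"
  let ?H = "{x. (cut_vector X - cut_vector Y) \<bullet> x = 0}"
  have "cut_vector X - cut_vector Y \<noteq> 0"
    using assms(1) cut_vector_inject by auto
  then have dimH: "dim ?H = (CARD('v) choose 2) - 1"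
    by (simp add: dim_hyperplane card_edge)
  have "?K \<subseteq> ?H"
  proof
    fix x assume "x \<in> ?K"
    then have "x \<bullet> cut_vector X = x \<bullet> cut_vector Y"
      by (auto simp: K_min_def intro: antisym)
    then show "x \<in> ?H" by (simp add: inner_diff_left inner_commute[of _ x])
  qed
  have near: "\<exists>t>0. c + t *\<^sub>R h \<in> ?K" if h: "h \<in> ?H" for h
  proof -
    have lim: "((\<lambda>t. (c + t *\<^sub>R h) \<bullet> v) \<longlongrightarrow> c \<bullet> v) (at_right 0)" for v
    proof -
      have "((\<lambda>t. (c + t *\<^sub>R h) \<bullet> v) \<longlongrightarrow> (c + 0 *\<^sub>R h) \<bullet> v) (at_right 0)"
        by (intro tendsto_intros)
      then show ?thesis by simp
    qed
    \<comment> \<open>Only finitely many strict inequalities must survive a small move along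
      \<open>h\<close>. Coordinates are written as inner products with unit vectors so that
      \<open>lim\<close> applies to them as well.\<close>
    have "\<forall>\<^sub>F t in at_right 0. \<forall>e. 0 < (c + t *\<^sub>R h) \<bullet> axis e 1"
      using pos by (intro eventually_all_finite order_tendstoD(1)[OF lim]) (simp add: inner_axis)
    moreover have "\<forall>\<^sub>F t in at_right 0.
        \<forall>Z. Z \<noteq> X \<longrightarrow> Z \<noteq> Y \<longrightarrow> 0 < (c + t *\<^sub>R h) \<bullet> (cut_vector Z - cut_vector X)"
    proof (intro eventually_all_finite)
      fix Z
      show "\<forall>\<^sub>F t in at_right 0.
          Z \<noteq> X \<longrightarrow> Z \<noteq> Y \<longrightarrow> 0 < (c + t *\<^sub>R h) \<bullet> (cut_vector Z - cut_vector X)"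
      proof (cases "Z = X \<or> Z = Y")
        case False
        then have "0 < c \<bullet> (cut_vector Z - cut_vector X)"
          using less[of Z] by (simp add: inner_diff_right)
        from order_tendstoD(1)[OF lim this] show ?thesis by eventually_elim simp
      qed auto
    qed
    ultimately have "\<forall>\<^sub>F t in at_right 0. 0 < t \<and> (\<forall>e. 0 < (c + t *\<^sub>R h) \<bullet> axis e 1) \<and>
        (\<forall>Z. Z \<noteq> X \<longrightarrow> Z \<noteq> Y \<longrightarrow> 0 < (c + t *\<^sub>R h) \<bullet> (cut_vector Z - cut_vector X))"
      using eventually_at_right_less[of "0::real"] by eventually_elim blast
    from eventually_happens'[OF _ this] obtain t where
      t: "0 < t" "\<And>e. 0 < (c + t *\<^sub>R h) \<bullet> axis e 1"
        "\<And>Z. Z \<noteq> X \<Longrightarrow> Z \<noteq> Y \<Longrightarrow> 0 < (c + t *\<^sub>R h) \<bullet> (cut_vector Z - cut_vector X)"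
      by auto
    let ?d = "c + t *\<^sub>R h"
    have eqd: "?d \<bullet> cut_vector X = ?d \<bullet> cut_vector Y"
      using eq h by (simp add: inner_add_left inner_diff_left inner_commute[of h])
    have "?d \<bullet> cut_vector X \<le> ?d \<bullet> cut_vector Z" for Z
    proof (cases "Z = X \<or> Z = Y")
      case False
      then show ?thesis using t(3)[of Z] by (simp only: inner_diff_right) simp
    qed (use eqd in auto)
    moreover have "0 \<le> ?d $ e" for e using t(2)[of e] by (simp add: inner_axis)
    ultimately have "?d \<in> ?K" using eqd by (simp add: K_min_def)
    then show ?thesis using t(1) by blast
  qed
  have "?H \<subseteq> span ?K"
  proof
    fix h assume "h \<in> ?H"
    from near[OF this] obtain t where t: "0 < t" "c + t *\<^sub>R h \<in> ?K" by blast
    \<comment> \<open>The direction 0 yields \<open>c\<close> itself, so \<open>h\<close> is a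
      multiple of a difference of two points of the common cone.\<close>
    have "c \<in> ?K" using near[of 0] by auto
    then have "(1 / t) *\<^sub>R ((c + t *\<^sub>R h) - c) \<in> span ?K"
      using t(2) by (intro span_scale span_diff span_base)
    then show "h \<in> span ?K" using t(1) by simp
  qed
  then have "dim ?H \<le> dim ?K" using dim_subset[of ?H "span ?K"] by simp
  moreover have "dim ?K \<le> dim ?H" using \<open>?K \<subseteq> ?H\<close> by (rule dim_subset)
  ultimately show ?thesis using assms(1) dimH by (simp add: cone_adjacent_def)
qed

lemma nested_adjacent:
  fixes S T :: "'v::card2 set"
  assumes "T \<subset> S" "T \<noteq> {}" "S \<noteq> UNIV"
  shows "cone_adjacent (abs_cut S) (abs_cut T)"
proof -
  define A B C where "A = T" and "B = S - T" and "C = - S"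
  note ABC = A_def B_def C_def
  let ?AB = "edges_between A B" and ?BC = "edges_between B C" and ?AC = "edges_between A C"
  \<comment> \<open>Dividing by the number of edges spreads each prescribed total evenly. The totals
    give \<open>S\<close> the weight 1 + 2, \<open>T\<close> the weight 2 + 1 and \<open>B\<close>,
    the only other cut that splits no class, the weight 2 + 2.\<close>
  define c :: "real ^ 'v edge" where
    "c = (\<chi> e. if e \<in> ?AB then 2 / card ?AB else if e \<in> ?BC then 2 / card ?BC
               else if e \<in> ?AC then 1 / card ?AC else 4)"
  have ne: "S \<noteq> {}" "S \<noteq> UNIV" "T \<noteq> {}" "T \<noteq> UNIV" using assms by auto
  have "A \<noteq> {}" "B \<noteq> {}" "C \<noteq> {}" using assms by (auto simp: ABC)
  have "e \<notin> ?AB \<inter> ?BC" "e \<notin> ?AB \<inter> ?AC" "e \<notin> ?BC \<inter> ?AC" for e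
    using assms(1) by (rule_tac edge_cases[of e]; auto simp: mem_edges_between_iff ABC)+
  then have disj: "?AB \<inter> ?BC = {}" "?AB \<inter> ?AC = {}" "?BC \<inter> ?AC = {}" by blast+
  have nempty: "?AB \<noteq> {}" "?BC \<noteq> {}" "?AC \<noteq> {}"
    using \<open>A \<noteq> {}\<close> \<open>B \<noteq> {}\<close> \<open>C \<noteq> {}\<close> assms(1)
    by (intro edges_between_nonempty; auto simp: ABC)+
  then have cards: "card ?AB > 0" "card ?BC > 0" "card ?AC > 0"
    by (simp_all add: card_gt_0_iff)
  have pos: "0 < c $ e" for e using cards by (simp add: c_def)
  have "sum (($) c) ?AB = (\<Sum>e\<in>?AB. 2 / card ?AB)" by (rule sum.cong) (simp_all add: c_def)
  then have AB: "sum (($) c) ?AB = 2" using nempty by simp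
  have "sum (($) c) ?BC = (\<Sum>e\<in>?BC. 2 / card ?BC)"
    using disj by (intro sum.cong) (auto simp: c_def)
  then have BC: "sum (($) c) ?BC = 2" using nempty by simp
  have "sum (($) c) ?AC = (\<Sum>e\<in>?AC. 1 / card ?AC)"
    using disj by (intro sum.cong) (auto simp: c_def)
  then have AC: "sum (($) c) ?AC = 1" using nempty by simp
  have union: "S = A \<union> B" "- S = C" "T = A" "- T = B \<union> C" "- B = A \<union> C"
    using assms(1) by (auto simp: ABC)
  have "edges_between S (- S) = ?AC \<union> ?BC"
    unfolding union(2) unfolding union(1) by (rule edges_between_Un_left)
  moreover have "edges_between T (- T) = ?AB \<union> ?AC"
    unfolding union(4) unfolding union(3) by (rule edges_between_Un_right)
  moreover have "edges_between B (- B) = ?AB \<union> ?BC"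
    unfolding union(5) by (simp only: edges_between_Un_right edges_between_commute[of B A])
  ultimately have S: "c \<bullet> set_vector S = 3" and T: "c \<bullet> set_vector T = 3" and B: "c \<bullet> set_vector B = 4"
    using disj AB BC AC by (simp_all add: inner_set_vector sum.union_disjoint Int_commute[of ?AC])
  \<comment> \<open>Splitting a class cuts an inner edge, which alone weighs 4.\<close>
  have split: "4 \<le> c \<bullet> set_vector U"
    if P: "P \<in> {A, B, C}" and ab: "a \<in> P" "b \<in> P" "a \<in> U" "b \<notin> U" for P a b U
  proof -
    have "a \<noteq> b" using ab by auto
    then obtain e where e: "endpoints e = {a, b}" by (rule edge_exists)
    have "e \<notin> ?AB \<union> ?BC \<union> ?AC"
      using P ab assms(1) by (auto simp: mem_edges_between_iff[OF \<open>a \<noteq> b\<close> e] ABC)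
    then have "4 = c $ e" by (simp add: c_def)
    also have "\<dots> \<le> sum (($) c) (edges_between U (- U))"
      using ab pos
      by (intro member_le_sum) (auto simp: mem_edges_between_iff[OF \<open>a \<noteq> b\<close> e] less_imp_le)
    finally show ?thesis by (simp add: inner_set_vector)
  qed
  have "c \<bullet> cut_vector (abs_cut S) < c \<bullet> cut_vector Z"
    if Z: "Z \<noteq> abs_cut S" "Z \<noteq> abs_cut T" for Z
  proof -
    obtain U where U: "U \<noteq> {}" "U \<noteq> UNIV" "Z = abs_cut U" by (rule cut_cases)
    have "4 \<le> c \<bullet> set_vector U"
    proof (cases "\<forall>P\<in>{A, B, C}. P \<subseteq> U \<or> P \<subseteq> - U")
      case True
      have "U \<noteq> S" "U \<noteq> - S" "U \<noteq> T" "U \<noteq> - T"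
        using Z U(3) abs_cut_Compl[OF ne(1,2)] abs_cut_Compl[OF ne(3,4)] by auto
      \<comment> \<open>Of the eight unions of classes, excluding the empty set and
        \<open>UNIV\<close> leaves the three classes and their complements, where
        \<open>T = A\<close> and \<open>- S = C\<close>.\<close>
      moreover have "U = S \<or> U = - S \<or> U = T \<or> U = - T \<or> U = B \<or> U = - B"
      proof -
        have all: "A \<union> B \<union> C = UNIV" by (auto simp: ABC)
        have P: "A \<subseteq> U \<or> A \<subseteq> - U" "B \<subseteq> U \<or> B \<subseteq> - U" "C \<subseteq> U \<or> C \<subseteq> - U"
          using True by auto
        have "U = (if A \<subseteq> U then A else {}) \<union> (if B \<subseteq> U then B else {}) \<union> (if C \<subseteq> U then C else {})"
          using P all by auto
        then show ?thesis
          using U(1,2) all union Un_commute[of A C]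
          by (cases "A \<subseteq> U"; cases "B \<subseteq> U"; cases "C \<subseteq> U") simp_all
      qed
      ultimately have "U = B \<or> U = - B" by blast
      then show ?thesis using B by (auto simp: set_vector_Compl)
    next
      case False
      then show ?thesis using split by blast
    qed
    then show ?thesis using S ne U by (simp add: cut_vector_abs_cut)
  qed
  moreover have "T \<noteq> S" "T \<noteq> - S" using assms by auto
  then have "abs_cut S \<noteq> abs_cut T" using abs_cut_eq_iff[OF ne] by simp
  moreover have "c \<bullet> cut_vector (abs_cut S) = c \<bullet> cut_vector (abs_cut T)"
    using S T by (simp add: cut_vector_abs_cut[OF ne(1,2)] cut_vector_abs_cut[OF ne(3,4)])
  ultimately show ?thesis using pos by (intro cone_adjacent_if_strict_minimiser[of _ _ c])
qed

section \<open>Counting the neighbours of a cut\<close>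

lemma adjacent_cuts_eq:
  assumes "S \<noteq> {}" "S \<noteq> UNIV"
  shows "{Y. cone_adjacent (abs_cut S) Y} =
    abs_cut ` ((Pow S - {{}, S}) \<union> (Pow (- S) - {{}, - S}))"
proof (intro set_eqI iffI)
  fix Y assume "Y \<in> {Y. cone_adjacent (abs_cut S) Y}"
  then have adj: "cone_adjacent (abs_cut S) Y" by simp
  obtain T where T: "T \<noteq> {}" "T \<noteq> UNIV" "Y = abs_cut T" by (rule cut_cases)
  have "abs_cut S \<noteq> abs_cut T" using adj T by (simp add: cone_adjacent_def)
  then have "T \<noteq> S" "T \<noteq> - S" using assms T by (auto simp: abs_cut_eq_iff)
  moreover have "S \<inter> T = {} \<or> S - T = {} \<or> T - S = {} \<or> S \<union> T = UNIV"
    using adj T crossing_not_adjacent by blast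
  \<comment> \<open>Each empty quadrant is an inclusion: in the order of the four alternatives,
    \<open>T\<close> in \<open>- S\<close>, \<open>- T\<close> in \<open>- S\<close>,
    \<open>T\<close> in \<open>S\<close>, and \<open>- T\<close> in \<open>S\<close>.\<close>
  ultimately have "T \<in> Pow S - {{}, S} \<or> - T \<in> Pow S - {{}, S} \<or>
      T \<in> Pow (- S) - {{}, - S} \<or> - T \<in> Pow (- S) - {{}, - S}"
    using T(1,2) by auto
  moreover have "Y = abs_cut (- T)" using T(3) abs_cut_Compl[OF T(1,2)] by simp
  ultimately show "Y \<in> abs_cut ` ((Pow S - {{}, S}) \<union> (Pow (- S) - {{}, - S}))"
    using T(3) UnI1 UnI2 image_eqI by metis
next
  fix Y assume "Y \<in> abs_cut ` ((Pow S - {{}, S}) \<union> (Pow (- S) - {{}, - S}))"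
  then obtain T where Y: "Y = abs_cut T"
    and "T \<in> (Pow S - {{}, S}) \<union> (Pow (- S) - {{}, - S})"
    by (rule imageE)
  then consider "T \<noteq> {}" "T \<subset> S" | "T \<noteq> {}" "T \<subset> - S" by auto
  then have "cone_adjacent (abs_cut S) (abs_cut T)"
  proof cases
    case 1
    then show ?thesis using assms by (intro nested_adjacent)
  next
    case 2
    \<comment> \<open>\<open>- S\<close> represents the same cut as \<open>S\<close>, so the nested
      case applies to it.\<close>
    moreover have "- S \<noteq> UNIV" using assms(1) by auto
    ultimately have "cone_adjacent (abs_cut (- S)) (abs_cut T)" by (intro nested_adjacent)
    then show ?thesis using abs_cut_Compl[OF assms] by simp
  qed
  then show "Y \<in> {Y. cone_adjacent (abs_cut S) Y}" using Y by simp
qed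

text \<open>Each side \<open>R\<close> contributes its nonempty proper subsets, and no neighbour is
  counted twice. Stating the count in \<open>int\<close> avoids truncated subtraction.\<close>

lemma cone_degree_abs_cut:
  fixes S :: "'v::card2 set"
  assumes "S \<noteq> {}" "S \<noteq> UNIV"
  shows "int (cone_degree (abs_cut S)) = 2 ^ card S + 2 ^ card (- S) - 4"
proof -
  let ?P = "\<lambda>S :: 'v set. Pow S - {{}, S}"
  have card_P: "int (card (?P R)) = 2 ^ card R - 2" if "R \<noteq> {}" for R :: "'v set"
  proof -
    have "card (?P R) = 2 ^ card R - 2"
      using that by (subst card_Diff_subset) (auto simp: card_Pow)
    moreover have "(2::nat) ^ 1 \<le> 2 ^ card R"
      using that by (intro power_increasing) (simp_all add: Suc_le_eq card_gt_0_iff)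
    ultimately show ?thesis by (simp add: of_nat_diff)
  qed
  have "inj_on abs_cut (?P S \<union> ?P (- S))"
  proof (rule inj_onI)
    fix T U assume TU: "T \<in> ?P S \<union> ?P (- S)" "U \<in> ?P S \<union> ?P (- S)" "abs_cut T = abs_cut U"
    then have "T \<noteq> {}" "T \<noteq> UNIV" "U \<noteq> {}" "U \<noteq> UNIV" using assms by auto
    then have "U = T \<or> U = - T" using TU(3) by (simp add: abs_cut_eq_iff)
    \<comment> \<open>The complement of a nonempty proper subset of one side contains the other side
      and meets its own, so it lies within neither side.\<close>
    moreover have "U \<noteq> - T" using TU(1,2) assms by blast
    ultimately show "T = U" by blast
  qed
  then have "cone_degree (abs_cut S) = card (?P S \<union> ?P (- S))"
    unfolding cone_degree_def adjacent_cuts_eq[OF assms] by (rule card_image)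
  also have "\<dots> = card (?P S) + card (?P (- S))"
    by (rule card_Un_disjoint) auto
  also have "int \<dots> = 2 ^ card S + 2 ^ card (- S) - 4"
  proof -
    have "- S \<noteq> {}" using assms(2) by blast
    then show ?thesis using card_P[OF assms(1)] card_P[of "- S"] by simp
  qed
  finally show ?thesis .
qed

theorem theorem6:
  fixes X :: "'v::card2 cut" and n k :: nat
  assumes "CARD('v) = n" and "n \<ge> 2"
    and "cut_card X = k"
  shows "int (cone_degree X) = 2 ^ (n - k) + 2 ^ k - 4"
proof -
  obtain S where S: "S \<noteq> {}" "S \<noteq> UNIV" "X = abs_cut S" by (rule cut_cases)
  have "card (- S) = n - card S" "card S \<le> n"
    using assms(1) by (auto simp: Compl_eq_Diff_UNIV card_Diff_subset intro: card_mono)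
  \<comment> \<open>Which side is the smaller does not matter, as the degree formula is symmetric in
    the two sides.\<close>
  moreover have "k = card S \<or> k = card (- S)"
    using assms(3) cut_card_abs_cut[OF S(1,2)] S(3) by (simp add: min_def split: if_splits)
  ultimately show ?thesis
    using cone_degree_abs_cut[OF S(1,2)] S(3) by auto
qed

end
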